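(* Let $L=\begin{pmatrix} NI & -X \\ -X^T & NI \end{pmatrix}$ be the signed Laplacian of an Adinkra with $N$ colors and vertex set $V$ (bosons ordered before fermions). Then: (1) the first $\#V/4$ invariant factors of $X$ are powers of $2$ that divide $N$, and the remaining $\#V/4$ invariant factors of $X$ are $N$ divided by powers of $2$; (2) the first $\#V/2$ invariant factors of $L$ are powers of $2$ that divide $N$, and the remaining $\#V/2$ invariant factors of $L$ are $N(N-1)$ divided by powers of $2$.
   Context: A signed graph is a finite undirected simple graph $(V,E)$ with a signature $\mu:E\to\{-1,1\}$; edges with $\mu(e)=-1$ are called dashed, those with $\mu(e)=1$ solid. An Adinkra with $N\ge 1$ colors is a non-empty finite bipartite signed graph $(V,E,\mu)$ (with a fixed bipartition of $V$ into bosons and fermions, every edge joining a boson to a fermion), together with an assignment of one of $N$ colors to each edge and a function $h:V\to\mathbb{Z}$ (the function $h$ plays no role here), such that: (i) each vertex is incident to exactly $N$ edges, one of each color; (ii) for any two distinct colors, the subgraph consisting of all edges of those two colors is a disjoint union of $4$-cycles (called bicolor cycles); (iii) every bicolor cycle contains an odd number of dashed edges; (iv) $|h(v)-h(w)|=1$ for adjacent $v,w$. An Adinkra need not be connected; there are $\#V/2$ bosons and $\#V/2$ fermions. $X$ is the $\frac{\#V}{2}\times\frac{\#V}{2}$ integer matrix whose $(i,j)$ entry is $\mu(e)$ if there is an edge $e$ between the $i$th boson and $j$th fermion, and $0$ otherwise. The signed Laplacian is $L=NI-A$, where $A=\begin{pmatrix} 0 & X \\ X^T & 0 \end{pmatrix}$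 is the signed adjacency matrix. The invariant factors of an integer square matrix are the nonnegative diagonal entries $d_1\mid d_2\mid\cdots$ of its Smith Normal Form over $\mathbb{Z}$, listed in this order with multiplicity (entries may be $0$). The number $1=2^0$ counts as a power of $2$. *)

theory Defs
  imports Jordan_Normal_Form.Matrix
begin

section \<open>Signed graphs and Adinkras\<close>

text \<open>Edges of a simple graph are two-element sets of vertices.\<close>

locale signed_graph =
  fixes V :: "'v set" and E :: "'v set set" and \<mu> :: "'v set \<Rightarrow> int"
  assumes finite_vertices: "finite V"
    and edges: "E \<subseteq> {{u, v} | u v. u \<in> V \<and> v \<in> V \<and> u \<noteq> v}"
    and signature: "\<And>e. e \<in> E \<Longrightarrow> \<mu> e \<in> {-1, 1}"

definition four_cycle :: "'v set set \<Rightarrow> bool" where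
  "four_cycle C \<longleftrightarrow>
     (\<exists>a b c d. distinct [a, b, c, d] \<and> C = {{a, b}, {b, c}, {c, d}, {d, a}})"

text \<open>A graph without isolated vertices is identified with its edge set;
  disjointness of cycles means vertex-disjointness.\<close>

definition disjoint_union_of_four_cycles :: "'v set set \<Rightarrow> bool" where
  "disjoint_union_of_four_cycles D \<longleftrightarrow>
     (\<exists>\<C>. (\<forall>C \<in> \<C>. four_cycle C)
        \<and> pairwise (\<lambda>C C'. disjnt (\<Union>C) (\<Union>C')) \<C> \<and> D = \<Union>\<C>)"

definition bicolor_edges :: "'v set set \<Rightarrow> ('v set \<Rightarrow> nat) \<Rightarrow> nat \<Rightarrow> nat \<Rightarrow> 'v set set" where
  "bicolor_edges E color i j = {e \<in> E. color e = i \<or> color e = j}"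

text \<open>If a graph is a vertex-disjoint union of 4-cycles, then the 4-cycles contained
  in it are exactly the constituents of that union, so \<open>bicolor_odd\<close> below ranges
  precisely over the bicolor cycles.\<close>

locale adinkra = signed_graph V E \<mu>
  for V :: "'v set" and E :: "'v set set" and \<mu> :: "'v set \<Rightarrow> int" +
  fixes N :: nat
    and bosons fermions :: "'v set"
    and color :: "'v set \<Rightarrow> nat"
    and h :: "'v \<Rightarrow> int"
  assumes N_pos: "N \<ge> 1"
    and nonempty: "V \<noteq> {}"
    and bipartition: "bosons \<union> fermions = V" "bosons \<inter> fermions = {}"
    and bipartite: "\<And>e. e \<in> E \<Longrightarrow> \<exists>b \<in> bosons. \<exists>f \<in> fermions. e = {b, f}"
    and color: "\<And>e. e \<in> E \<Longrightarrow> color e \<in> {1..N}"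
    and one_edge_of_each_color:
      "\<And>v i. v \<in> V \<Longrightarrow> i \<in> {1..N} \<Longrightarrow> \<exists>!e. e \<in> E \<and> v \<in> e \<and> color e = i"
    and bicolor_cycles:
      "\<And>i j. i \<in> {1..N} \<Longrightarrow> j \<in> {1..N} \<Longrightarrow> i \<noteq> j \<Longrightarrow>
         disjoint_union_of_four_cycles (bicolor_edges E color i j)"
    and bicolor_odd:
      "\<And>i j C. i \<in> {1..N} \<Longrightarrow> j \<in> {1..N} \<Longrightarrow> i \<noteq> j \<Longrightarrow>
         four_cycle C \<Longrightarrow> C \<subseteq> bicolor_edges E color i j \<Longrightarrow>
         odd (card {e \<in> C. \<mu> e = -1})"
    and height: "\<And>v w. {v, w} \<in> E \<Longrightarrow> \<bar>h v - h w\<bar> = 1"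
begin

lemma boson_edge:
  assumes "e \<in> E"
  shows "\<exists>!b. b \<in> bosons \<and> b \<in> e"
  using bipartite[OF assms] bipartition(2) by auto

lemma fermion_edge:
  assumes "e \<in> E"
  shows "\<exists>!f. f \<in> fermions \<and> f \<in> e"
  using bipartite[OF assms] bipartition(2) by auto

lemma card_bosons_eq_card_fermions: "card bosons = card fermions"
proof -
  define M where "M = {e \<in> E. color e = 1}"
  have 1: "1 \<in> {1..N}"
    using N_pos by simp
  have incident: "\<exists>!e. e \<in> M \<and> v \<in> e" if "v \<in> V" for v
    using one_edge_of_each_color[OF that 1] by (auto simp: M_def)
  have bij: "card S = card M"
    if S: "S \<subseteq> V" and meet: "\<And>e. e \<in> E \<Longrightarrow> \<exists>!v. v \<in> S \<and> v \<in> e" for S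
  proof (rule bij_betw_same_card)
    show "bij_betw (\<lambda>v. THE e. e \<in> M \<and> v \<in> e) S M"
    proof (rule bij_betwI[where g = "\<lambda>e. THE v. v \<in> S \<and> v \<in> e"])
      show "(\<lambda>v. THE e. e \<in> M \<and> v \<in> e) \<in> S \<rightarrow> M"
        using theI'[OF incident] S by blast
      show "(\<lambda>e. THE v. v \<in> S \<and> v \<in> e) \<in> M \<rightarrow> S"
        using theI'[OF meet] by (auto simp: M_def)
      show "(THE w. w \<in> S \<and> w \<in> (THE e. e \<in> M \<and> v \<in> e)) = v" if "v \<in> S" for v
      proof -
        from that S have "v \<in> V" by auto
        from theI'[OF incident[OF this]] have
          "(THE e. e \<in> M \<and> v \<in> e) \<in> E" "v \<in> (THE e. e \<in> M \<and> v \<in> e)"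
          by (auto simp: M_def)
        then show ?thesis
          using that by (intro the1_equality[OF meet]) auto
      qed
      show "(THE e'. e' \<in> M \<and> (THE v. v \<in> S \<and> v \<in> e) \<in> e') = e" if "e \<in> M" for e
      proof -
        from that have "e \<in> E" by (simp add: M_def)
        from theI'[OF meet[OF this]] that S show ?thesis
          by (intro the1_equality[OF incident]) auto
      qed
    qed
  qed
  from bij[of bosons] bij[of fermions] boson_edge fermion_edge bipartition(1)
  show ?thesis by auto
qed

lemma card_vertices: "card V = 2 * card bosons"
proof -
  have "finite bosons" "finite fermions"
    using finite_vertices bipartition(1) by auto
  then show ?thesis
    using card_Un_disjoint[of bosons fermions] bipartition card_bosons_eq_card_fermions
    by simp
qed

text \<open>For \<open>N = 1\<close> the number of vertices need not be divisible by 4.\<close>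

lemma four_dvd_card_vertices:
  assumes "N \<ge> 2"
  shows "4 dvd card V"
proof -
  have ij: "(1::nat) \<in> {1..N}" "2 \<in> {1..N}" "(1::nat) \<noteq> 2"
    using assms by auto
  from bicolor_cycles[OF ij] obtain \<C> where
    cycles: "\<And>C. C \<in> \<C> \<Longrightarrow> four_cycle C" and
    disj: "pairwise (\<lambda>C C'. disjnt (\<Union>C) (\<Union>C')) \<C>" and
    union: "bicolor_edges E color 1 2 = \<Union>\<C>"
    unfolding disjoint_union_of_four_cycles_def by blast
  have card4: "card (\<Union>C) = 4" if "C \<in> \<C>" for C
  proof -
    from cycles[OF that] obtain a b c d where
      "distinct [a, b, c, d]" "C = {{a, b}, {b, c}, {c, d}, {d, a}}"
      unfolding four_cycle_def by blast
    moreover from this have "\<Union>C = set [a, b, c, d]" by auto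
    ultimately show ?thesis by (simp add: distinct_card)
  qed
  have V: "V = \<Union>(\<Union> ` \<C>)"
  proof
    show "V \<subseteq> \<Union>(\<Union> ` \<C>)"
    proof
      fix v assume "v \<in> V"
      from one_edge_of_each_color[OF this ij(1)] obtain e
        where "e \<in> bicolor_edges E color 1 2" "v \<in> e"
        by (auto simp: bicolor_edges_def)
      then show "v \<in> \<Union>(\<Union> ` \<C>)" unfolding union by auto
    qed
    have "\<Union>\<C> \<subseteq> E" unfolding union[symmetric] bicolor_edges_def by auto
    then show "\<Union>(\<Union> ` \<C>) \<subseteq> V" using edges by fastforce
  qed
  have "pairwise disjnt (\<Union> ` \<C>)"
    using disj by (force simp: pairwise_def)
  moreover have "finite W" if "W \<in> \<Union> ` \<C>" for W
    using finite_subset[OF _ finite_vertices, of W] V that by blast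
  ultimately have "card V = (\<Sum>W \<in> \<Union> ` \<C>. card W)"
    unfolding V by (intro card_Union_disjoint) auto
  also have "4 dvd \<dots>"
    using card4 by (intro dvd_sum) auto
  finally show ?thesis .
qed

end

section \<open>Matrices of an Adinkra\<close>

text \<open>The lists \<open>bs\<close> and \<open>fs\<close> enumerate the bosons and the fermions.\<close>

definition boson_fermion_mat ::
  "'v set set \<Rightarrow> ('v set \<Rightarrow> int) \<Rightarrow> 'v list \<Rightarrow> 'v list \<Rightarrow> int mat" where
  "boson_fermion_mat E \<mu> bs fs = mat (length bs) (length fs)
     (\<lambda>(i, j). if {bs ! i, fs ! j} \<in> E then \<mu> {bs ! i, fs ! j} else 0)"

definition signed_adjacency_mat :: "int mat \<Rightarrow> int mat" where
  "signed_adjacency_mat X = four_block_mat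
     (0\<^sub>m (dim_row X) (dim_row X)) X
     (transpose_mat X) (0\<^sub>m (dim_col X) (dim_col X))"

definition signed_laplacian :: "nat \<Rightarrow> int mat \<Rightarrow> int mat" where
  "signed_laplacian N X =
     int N \<cdot>\<^sub>m 1\<^sub>m (dim_row X + dim_col X) - signed_adjacency_mat X"

lemma signed_laplacian_block:
  "signed_laplacian N X = four_block_mat
     (int N \<cdot>\<^sub>m 1\<^sub>m (dim_row X)) (- X)
     (- transpose_mat X) (int N \<cdot>\<^sub>m 1\<^sub>m (dim_col X))"
  by (rule eq_matI) (auto simp: signed_laplacian_def signed_adjacency_mat_def)

section \<open>Smith normal form over the integers\<close>

definition smith_normal_form_of :: "int mat \<Rightarrow> int mat \<Rightarrow> bool" where
  "smith_normal_form_of A D \<longleftrightarrow>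
     (\<exists>n P Q. {A, D, P, Q} \<subseteq> carrier_mat n n
        \<and> invertible_mat P \<and> invertible_mat Q \<and> D = P * A * Q
        \<and> diagonal_mat D
        \<and> (\<forall>i < n. 0 \<le> D $$ (i, i))
        \<and> (\<forall>i. Suc i < n \<longrightarrow> D $$ (i, i) dvd D $$ (Suc i, Suc i)))"

text \<open>\<open>invariant_factors A ds\<close>: the list of invariant factors of the square matrix
  \<open>A\<close> is \<open>ds\<close>.\<close>

definition invariant_factors :: "int mat \<Rightarrow> int list \<Rightarrow> bool" where
  "invariant_factors A ds \<longleftrightarrow> (\<exists>D. smith_normal_form_of A D \<and> ds = diag_mat D)"

end

theory Submission
  imports Defs Jordan_Normal_Form.Determinant
begin

text \<open>
  Let n be the number of bosons. The edges of one colour c form a perfect matching, so their signed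
  incidence matrix S_c is a signed permutation matrix, and X is the sum of the S_c. That every
  bicolor cycle has an odd number of dashed edges means that S_c S_d^T + S_d S_c^T = 0 for distinct
  c and d, and the same holds with bosons and fermions exchanged. With S = S_1 this yields the
  relations collected in the locale \<open>adinkra_matrices\<close>: S is orthogonal, X X^T = X^T X = N I, and
  S X^T + X S^T = 2 I. The rest of the proof is linear algebra with these relations.

  Two arguments locate the invariant factors d_0 | d_1 | ... of a square matrix A of size m.

  \<^item> Complementary factors (\<open>mult_complementary\<close>). If A B = g I and B has the same Smith Normal Form
    as A, then d_i d_(m-1-i) = g. This applies to X and X^T with g = N, and to L and its conjugate
    under the sign change of all fermions with g = N (N - 1). The case g = 0 is included; it occurs
    for L when N = 1.

  \<^item> The lower half (\<open>lower_half_dvd_det_sum\<close>). If B has the same Smith Normal Form as A, then every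
    d_i with 2 i < m divides det (A + B). For X one takes B = S X^T S, because
    S X^T + X S^T = 2 I says that X + B = 2 S; so the lower half of the invariant factors of X
    divides a power of 2. For L, two different sums give two determinants; together they show
    that the lower half contains no odd prime, and not the prime 2 either if N is odd.

  Both arguments rest on one observation about permutations (\<open>dvd_det_of_dvd_block\<close>): every
  permutation of m points meets an a by b block of the matrix if a + b > m, so a common divisor of
  such a block divides the determinant. In this way no rank modulo a prime has to be considered.

  So the lower half consists of powers of 2. It divides N, and the upper half is the lower half
  complemented: for X this is the first argument alone; for L the first argument gives a divisor of
  N (N - 1), which divides N since it is a power of 2, and equal to 1 when N is odd.
\<close>

section \<open>Determinants and blocks of common divisors\<close>

text \<open>In the Leibniz formula, a permutation p sends the rows I to card I columns, and
  card I + card J > n forces one of them into J. So every term contains an entry of the block.\<close>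

lemma dvd_det_of_dvd_block:
  fixes M :: "int mat"
  assumes M: "M \<in> carrier_mat n n"
    and I: "I \<subseteq> {..<n}" and J: "J \<subseteq> {..<n}" and large: "n < card I + card J"
    and block: "\<And>i j. i \<in> I \<Longrightarrow> j \<in> J \<Longrightarrow> g dvd M $$ (i, j)"
  shows "g dvd det M"
proof -
  have "g dvd (\<Prod>i = 0..<n. M $$ (i, p i))" if p: "p permutes {0..<n}" for p
  proof -
    have "card (p ` I) = card I"
      using p by (intro card_image) (metis inj_on_subset permutes_inj subset_UNIV)
    moreover have "p ` I \<subseteq> {..<n}"
      using I permutes_image[OF p] by (auto simp: atLeast0LessThan)
    moreover have "card (p ` I \<union> J) \<le> n" if "p ` I \<inter> J = {}"
      using calculation J card_mono[of "{..<n}" "p ` I \<union> J"] by simp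
    ultimately have "p ` I \<inter> J \<noteq> {}"
      using large J card_Un_disjoint[of "p ` I" J] finite_subset[of _ "{..<n}"]
      by (metis finite_lessThan not_less)
    then obtain i where i: "i \<in> I" "p i \<in> J" by blast
    have "i \<in> {0..<n}" using i I by auto
    then have "M $$ (i, p i) dvd (\<Prod>i = 0..<n. M $$ (i, p i))"
      by (intro dvd_prodI) auto
    then show ?thesis using block[OF i] dvd_trans by blast
  qed
  then show ?thesis
    unfolding det_def'[OF M] by (auto intro!: dvd_sum)
qed

text \<open>In the application M is a unimodular matrix on both sides of which diagonal entries have been
  pulled out; the lemma then cancels M. The reason is that g / gcd g t divides the whole
  block, hence the unit det M. The division by the gcd replaces the comparison of g
  and t at each prime.\<close>

lemma dvd_of_dvd_mult_block:
  fixes M :: "int mat"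
  assumes M: "M \<in> carrier_mat n n" and unit: "det M dvd 1"
    and I: "I \<subseteq> {..<n}" and J: "J \<subseteq> {..<n}" and large: "n < card I + card J"
    and block: "\<And>i j. i \<in> I \<Longrightarrow> j \<in> J \<Longrightarrow> g dvd t * M $$ (i, j)"
  shows "g dvd t"
proof (cases "t = 0")
  case False
  define q where "q = g div gcd g t"
  have "q dvd M $$ (i, j)" if "i \<in> I" "j \<in> J" for i j
  proof -
    have "g = gcd g t * q" "t = gcd g t * (t div gcd g t)" by (auto simp: q_def)
    then have "gcd g t * q dvd gcd g t * ((t div gcd g t) * M $$ (i, j))"
      using block[OF that] by (metis mult.assoc)
    then have "q dvd (t div gcd g t) * M $$ (i, j)" using False by simp
    moreover have "coprime q (t div gcd g t)"
      using False unfolding q_def by (intro div_gcd_coprime) auto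
    ultimately show ?thesis by (simp add: coprime_dvd_mult_right_iff)
  qed
  then have "q dvd det M" by (intro dvd_det_of_dvd_block[OF M I J large])
  then have "q dvd 1" using unit dvd_trans by blast
  then have "q * gcd g t dvd 1 * t" by (intro mult_dvd_mono) auto
  then show ?thesis by (simp add: q_def)
qed simp

section \<open>Unimodular equivalence\<close>

definition inverse_mats :: "nat \<Rightarrow> int mat \<Rightarrow> int mat \<Rightarrow> bool" where
  "inverse_mats n P P' \<longleftrightarrow> P \<in> carrier_mat n n \<and> P' \<in> carrier_mat n n
     \<and> P * P' = 1\<^sub>m n \<and> P' * P = 1\<^sub>m n"

lemma inverse_mats_sym: "inverse_mats n P P' \<Longrightarrow> inverse_mats n P' P"
  by (auto simp: inverse_mats_def)

lemma inverse_mats_mult: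
  assumes "inverse_mats n P P'" "inverse_mats n Q Q'"
  shows "inverse_mats n (P * Q) (Q' * P')"
proof -
  have c: "P \<in> carrier_mat n n" "P' \<in> carrier_mat n n" "Q \<in> carrier_mat n n" "Q' \<in> carrier_mat n n"
    using assms by (auto simp: inverse_mats_def)
  have "P * Q * (Q' * P') = P * (Q * Q') * P'"
    using c by (simp add: assoc_mult_mat[of _ n n _ n _ n])
  moreover have "Q' * P' * (P * Q) = Q' * (P' * P) * Q"
    using c by (simp add: assoc_mult_mat[of _ n n _ n _ n])
  ultimately show ?thesis using assms c by (auto simp: inverse_mats_def)
qed

lemma inverse_mats_transpose:
  assumes "inverse_mats n P P'"
  shows "inverse_mats n (transpose_mat P) (transpose_mat P')"
  using assms transpose_mult[of P n n P' n, symmetric] transpose_mult[of P' n n P n, symmetric]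
  by (simp add: inverse_mats_def)

lemma inverse_mats_involution:
  assumes "P \<in> carrier_mat m m" "P * P = 1\<^sub>m m"
  shows "inverse_mats m P P"
  using assms by (simp add: inverse_mats_def)

lemma inverse_mats_det_unit:
  assumes "inverse_mats n P P'"
  shows "det P dvd 1"
proof -
  have "det P * det P' = 1"
    using assms det_mult[of P n P'] by (simp add: inverse_mats_def)
  then show ?thesis by (metis dvd_triv_left)
qed

lemma inverse_mats_cancel:
  assumes "inverse_mats n P P'" "A \<in> carrier_mat n m"
  shows "P * (P' * A) = A"
  using assms assoc_mult_mat[of P n n P' n A m] by (auto simp: inverse_mats_def)

definition equivalent_mats :: "nat \<Rightarrow> int mat \<Rightarrow> int mat \<Rightarrow> bool" where
  "equivalent_mats n A B \<longleftrightarrow> A \<in> carrier_mat n n \<and>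
     (\<exists>P P' Q Q'. inverse_mats n P P' \<and> inverse_mats n Q Q' \<and> B = P * A * Q)"

lemma equivalent_matsI:
  assumes "A \<in> carrier_mat n n" "inverse_mats n P P'" "inverse_mats n Q Q'" "B = P * A * Q"
  shows "equivalent_mats n A B"
  using assms by (auto simp: equivalent_mats_def)

lemma equivalent_mats_carrier:
  "equivalent_mats n A B \<Longrightarrow> A \<in> carrier_mat n n \<and> B \<in> carrier_mat n n"
  by (auto simp: equivalent_mats_def inverse_mats_def)

lemma equivalent_mats_sym:
  assumes "equivalent_mats n A B"
  shows "equivalent_mats n B A"
proof -
  obtain P P' Q Q' where inv: "inverse_mats n P P'" "inverse_mats n Q Q'"
    and A: "A \<in> carrier_mat n n" and B: "B = P * A * Q"
    using assms by (auto simp: equivalent_mats_def)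
  have c: "P \<in> carrier_mat n n" "P' \<in> carrier_mat n n" "Q \<in> carrier_mat n n" "Q' \<in> carrier_mat n n"
    using inv by (auto simp: inverse_mats_def)
  have "P' * B * Q' = P' * (P * (A * (Q * Q')))"
    using c A by (simp add: B assoc_mult_mat[of _ n n _ n _ n])
  also have "\<dots> = A"
    using inverse_mats_cancel[OF inverse_mats_sym[OF inv(1)], of "A * (Q * Q')" n] inv(2) A
    by (auto simp: inverse_mats_def)
  finally show ?thesis
    using inverse_mats_sym inv c A B by (intro equivalent_matsI[of B n P' P Q' Q A]) auto
qed

lemma equivalent_mats_trans:
  assumes "equivalent_mats n A B" "equivalent_mats n B C"
  shows "equivalent_mats n A C"
proof -
  obtain P P' Q Q' where 1: "inverse_mats n P P'" "inverse_mats n Q Q'"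
    and A: "A \<in> carrier_mat n n" and B: "B = P * A * Q"
    using assms(1) by (auto simp: equivalent_mats_def)
  obtain R R' S S' where 2: "inverse_mats n R R'" "inverse_mats n S S'"
    and C: "C = R * B * S"
    using assms(2) by (auto simp: equivalent_mats_def)
  have c: "P \<in> carrier_mat n n" "Q \<in> carrier_mat n n" "R \<in> carrier_mat n n" "S \<in> carrier_mat n n"
    using 1 2 by (auto simp: inverse_mats_def)
  have "C = (R * P) * A * (Q * S)"
    using c A by (simp add: B C assoc_mult_mat[of _ n n _ n _ n])
  then show ?thesis
    using A inverse_mats_mult[OF 2(1) 1(1)] inverse_mats_mult[OF 1(2) 2(2)]
    by (rule equivalent_matsI[rotated 3])
qed

lemma equivalent_mats_transpose:
  assumes "equivalent_mats n A B"
  shows "equivalent_mats n (transpose_mat A) (transpose_mat B)"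
proof -
  obtain P P' Q Q' where inv: "inverse_mats n P P'" "inverse_mats n Q Q'"
    and A: "A \<in> carrier_mat n n" and B: "B = P * A * Q"
    using assms by (auto simp: equivalent_mats_def)
  have c: "P \<in> carrier_mat n n" "Q \<in> carrier_mat n n"
    using inv by (auto simp: inverse_mats_def)
  have "transpose_mat B = transpose_mat Q * transpose_mat A * transpose_mat P"
    using c A transpose_mult[of "P * A" n n Q n] transpose_mult[of P n n A n]
    by (simp add: B assoc_mult_mat[of _ n n _ n _ n])
  then show ?thesis
    using inv A by (intro equivalent_matsI[OF _ inverse_mats_transpose inverse_mats_transpose]) auto
qed

section \<open>Two bounds on invariant factors\<close>

locale smith_diagonal =
  fixes n :: nat and D :: "int mat"
  assumes carrier: "D \<in> carrier_mat n n"
    and diagonal: "\<And>i j. i < n \<Longrightarrow> j < n \<Longrightarrow> i \<noteq> j \<Longrightarrow> D $$ (i, j) = 0"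
    and nonneg: "\<And>i. i < n \<Longrightarrow> 0 \<le> D $$ (i, i)"
    and dvd_Suc: "\<And>i. Suc i < n \<Longrightarrow> D $$ (i, i) dvd D $$ (Suc i, Suc i)"
begin

lemma dvd_le:
  assumes "i \<le> j" "j < n"
  shows "D $$ (i, i) dvd D $$ (j, j)"
  using assms
proof (induction j rule: dec_induct)
  case (step k)
  then show ?case using dvd_Suc[of k] dvd_trans by auto
qed simp

lemma mult_left_entry:
  assumes "M \<in> carrier_mat n n" "i < n" "j < n"
  shows "(D * M) $$ (i, j) = D $$ (i, i) * M $$ (i, j)"
proof -
  have "(D * M) $$ (i, j) = (\<Sum>k = 0..<n. D $$ (i, k) * M $$ (k, j))"
    using assms carrier by (simp add: scalar_prod_def)
  also have "\<dots> = (\<Sum>k = 0..<n. if k = i then D $$ (i, i) * M $$ (i, j) else 0)"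
    using assms diagonal by (intro sum.cong) auto
  finally show ?thesis using assms by simp
qed

lemma mult_right_entry:
  assumes "M \<in> carrier_mat n n" "i < n" "j < n"
  shows "(M * D) $$ (i, j) = M $$ (i, j) * D $$ (j, j)"
proof -
  have "(M * D) $$ (i, j) = (\<Sum>k = 0..<n. M $$ (i, k) * D $$ (k, j))"
    using assms carrier by (simp add: scalar_prod_def)
  also have "\<dots> = (\<Sum>k = 0..<n. if k = j then M $$ (i, j) * D $$ (j, j) else 0)"
    using assms diagonal by (intro sum.cong) auto
  finally show ?thesis using assms by simp
qed

text \<open>Write A = P D Q and B = R D S. Multiplying A + B by units on both sides makes the left factor of
  one summand and the right factor of the other disappear, leaving (R^-1 P) D + D (S Q^-1). Its
  entries with both indices at least i are divisible by the i-th diagonal entry, and this square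
  block is larger than half the matrix.\<close>

lemma lower_half_dvd_det_sum:
  assumes A: "equivalent_mats n A D" and B: "equivalent_mats n B D" and i: "2 * i < n"
  shows "D $$ (i, i) dvd det (A + B)"
proof -
  obtain P P' Q Q' where 1: "inverse_mats n P P'" "inverse_mats n Q Q'"
    and A_eq: "A = P * D * Q"
    using equivalent_mats_sym[OF A] by (auto simp: equivalent_mats_def)
  obtain R R' S S' where 2: "inverse_mats n R R'" "inverse_mats n S S'"
    and B_eq: "B = R * D * S"
    using equivalent_mats_sym[OF B] by (auto simp: equivalent_mats_def)
  have c: "P \<in> carrier_mat n n" "Q \<in> carrier_mat n n" "R \<in> carrier_mat n n" "S \<in> carrier_mat n n"
      "Q' \<in> carrier_mat n n" "R' \<in> carrier_mat n n" "A \<in> carrier_mat n n" "B \<in> carrier_mat n n"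
    using 1 2 equivalent_mats_carrier A B by (auto simp: inverse_mats_def)
  define M where "M = R' * (A + B) * Q'"
  have "R' * A * Q' = R' * P * D"
    using c carrier 1(2) by (simp add: A_eq assoc_mult_mat[of _ n n _ n _ n] inverse_mats_def)
  moreover have "R' * B * Q' = D * (S * Q')"
    using c carrier inverse_mats_cancel[OF inverse_mats_sym[OF 2(1)], of "D * (S * Q')" n]
    by (simp add: B_eq assoc_mult_mat[of _ n n _ n _ n])
  ultimately have M: "M = R' * P * D + D * (S * Q')"
    using c by (simp add: M_def mult_add_distrib_mat[of _ n n _ n] add_mult_distrib_mat[of _ n n _ _ n])
  have "D $$ (i, i) dvd M $$ (j, k)" if "j \<in> {i..<n}" "k \<in> {i..<n}" for j k
    using that c carrier dvd_le[of i j] dvd_le[of i k]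
    by (simp add: M mult_left_entry mult_right_entry del: assoc_mult_mat index_mult_mat(1))
  then have "D $$ (i, i) dvd det M"
    using i c carrier by (intro dvd_det_of_dvd_block[of M n "{i..<n}" "{i..<n}"]) (auto simp: M)
  also have "det M = det R' * det (A + B) * det Q'"
    using c by (simp add: M_def det_mult[of _ n])
  also have "\<dots> dvd det (A + B)"
    using inverse_mats_det_unit[OF inverse_mats_sym[OF 2(1)]]
      inverse_mats_det_unit[OF inverse_mats_sym[OF 1(2)]]
    by (metis dvd_refl mult.commute mult_dvd_mono mult_1)
  finally show ?thesis .
qed

text \<open>With A = P D Q and B = R D S the hypothesis A B = g I becomes D W D = g U for the unimodular
  matrices W = Q R and U = P^-1 S^-1, that is, d_i d_j W_ij = g U_ij. Let t = d_k d_(n-1-k). For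
  i \<le> k and j \<le> n-1-k the product d_i d_j divides t, so g divides t W_ij, and W can be cancelled
  because k+1 rows and n-k columns are too many for a proper common divisor. The opposite corner,
  with U in place of W, shows that t divides g.\<close>

lemma mult_complementary:
  assumes A: "equivalent_mats n A D" and B: "equivalent_mats n B D"
    and AB: "A * B = g \<cdot>\<^sub>m 1\<^sub>m n" and g: "0 \<le> g" and k: "k < n"
  shows "D $$ (k, k) * D $$ (n - 1 - k, n - 1 - k) = g"
proof -
  obtain P P' Q Q' where 1: "inverse_mats n P P'" "inverse_mats n Q Q'"
    and A_eq: "A = P * D * Q"
    using equivalent_mats_sym[OF A] by (auto simp: equivalent_mats_def)
  obtain R R' S S' where 2: "inverse_mats n R R'" "inverse_mats n S S'"
    and B_eq: "B = R * D * S"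
    using equivalent_mats_sym[OF B] by (auto simp: equivalent_mats_def)
  have c: "P \<in> carrier_mat n n" "Q \<in> carrier_mat n n" "R \<in> carrier_mat n n" "S \<in> carrier_mat n n"
      "P' \<in> carrier_mat n n" "S' \<in> carrier_mat n n" "A \<in> carrier_mat n n" "B \<in> carrier_mat n n"
    using 1 2 equivalent_mats_carrier A B by (auto simp: inverse_mats_def)
  define W where "W = Q * R"
  define U where "U = P' * S'"
  have WU: "W \<in> carrier_mat n n" "U \<in> carrier_mat n n" using c by (auto simp: W_def U_def)
  have det: "det W dvd 1" "det U dvd 1"
    using inverse_mats_det_unit[OF inverse_mats_mult[OF 1(2) 2(1)]]
      inverse_mats_det_unit[OF inverse_mats_mult[OF inverse_mats_sym[OF 1(1)] inverse_mats_sym[OF 2(2)]]]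
    by (simp_all add: W_def U_def)
  have "P' * (A * B) * S' = D * (W * D)"
  proof -
    have "P' * (A * B) * S' = P' * (P * (D * (Q * (R * (D * (S * S'))))))"
      using c carrier by (simp add: A_eq B_eq assoc_mult_mat[of _ n n _ n _ n])
    also have "\<dots> = D * (Q * (R * (D * (S * S'))))"
      using c carrier by (intro inverse_mats_cancel[OF inverse_mats_sym[OF 1(1)], of _ n]) auto
    also have "S * S' = 1\<^sub>m n" using 2(2) by (simp add: inverse_mats_def)
    finally show ?thesis
      using c carrier by (simp add: W_def assoc_mult_mat[of _ n n _ n _ n])
  qed
  moreover have "P' * (A * B) * S' = g \<cdot>\<^sub>m U"
    using c by (simp add: AB U_def mult_smult_distrib[of _ n n _ n] mult_smult_assoc_mat[of _ n n _ n])
  ultimately have eq: "D * (W * D) = g \<cdot>\<^sub>m U" by simp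
  have entry: "D $$ (i, i) * D $$ (j, j) * W $$ (i, j) = g * U $$ (i, j)" if "i < n" "j < n" for i j
  proof -
    have "(D * (W * D)) $$ (i, j) = (g \<cdot>\<^sub>m U) $$ (i, j)" using eq by simp
    then show ?thesis
      using that c carrier WU
      by (simp add: mult_left_entry mult_right_entry mult_ac del: assoc_mult_mat index_mult_mat(1))
  qed
  define k' where "k' = n - 1 - k"
  have k': "k' < n" "k + k' = n - 1" using k by (auto simp: k'_def)
  define t where "t = D $$ (k, k) * D $$ (k', k')"
  have "g dvd t"
  proof (rule dvd_of_dvd_mult_block[OF WU(1) det(1), of "{..k}" "{..k'}"])
    fix i j assume ij: "i \<in> {..k}" "j \<in> {..k'}"
    then have "g dvd D $$ (i, i) * D $$ (j, j) * W $$ (i, j)" using entry k k' by simp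
    also have "\<dots> dvd t * W $$ (i, j)"
      unfolding t_def using ij k k' by (intro mult_dvd_mono dvd_le) auto
    finally show "g dvd t * W $$ (i, j)" .
  qed (use k k' in auto)
  moreover have "t dvd g"
  proof (rule dvd_of_dvd_mult_block[OF WU(2) det(2), of "{k..<n}" "{k'..<n}"])
    fix i j assume ij: "i \<in> {k..<n}" "j \<in> {k'..<n}"
    then have "t dvd D $$ (i, i) * D $$ (j, j)"
      unfolding t_def by (intro mult_dvd_mono dvd_le) auto
    then show "t dvd g * U $$ (i, j)" using entry[of i j] ij by (metis dvd_mult2 atLeastLessThan_iff)
  qed (use k k' in auto)
  moreover have "0 \<le> t" using nonneg k k' by (simp add: t_def)
  ultimately have "t = g" using g by (simp add: zdvd_antisym_nonneg)
  then show ?thesis by (simp add: t_def k'_def)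
qed

lemma transpose_eq: "transpose_mat D = D"
  using carrier diagonal by (intro eq_matI) (auto, metis)

end

text \<open>The existentially quantified size in the definition of the Smith Normal Form is determined by A,
  and inverses of square matrices have the same size.\<close>

lemma smith_normal_form_ofE:
  assumes "smith_normal_form_of A D" "A \<in> carrier_mat n n"
  shows "smith_diagonal n D" "equivalent_mats n A D"
proof -
  obtain m P Q where c: "{A, D, P, Q} \<subseteq> carrier_mat m m"
    and inv: "invertible_mat P" "invertible_mat Q" and D: "D = P * A * Q"
    and dg: "diagonal_mat D" "\<forall>i < m. 0 \<le> D $$ (i, i)"
      "\<forall>i. Suc i < m \<longrightarrow> D $$ (i, i) dvd D $$ (Suc i, Suc i)"
    using assms(1) by (auto simp: smith_normal_form_of_def)
  have [simp]: "m = n" using c assms(2) by auto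
  have ex: "\<exists>B. inverse_mats n A B" if A: "A \<in> carrier_mat n n" "invertible_mat A" for A
  proof -
    obtain B where B: "A * B = 1\<^sub>m (dim_row A)" "B * A = 1\<^sub>m (dim_row B)"
      using A(2) by (auto simp: invertible_mat_def inverts_mat_def)
    have "dim_col B = n" using A arg_cong[OF B(1), of dim_col] by simp
    moreover have "dim_row B = n" using A arg_cong[OF B(2), of dim_col] by simp
    ultimately show ?thesis using A B by (auto simp: inverse_mats_def intro!: exI[of _ B])
  qed
  show "smith_diagonal n D"
    using c dg by unfold_locales (auto simp: diagonal_mat_def)
  obtain P' Q' where "inverse_mats n P P'" "inverse_mats n Q Q'"
    using ex[of P] ex[of Q] inv c by auto
  then show "equivalent_mats n A D"
    using D assms(2) by (intro equivalent_matsI)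
qed

section \<open>Colour pairings in an Adinkra\<close>

text \<open>A 4-cycle is given up to rotation and reflection; this normal form starts it at a chosen path of
  two edges.\<close>

lemma four_cycle_through_path:
  assumes "four_cycle C" "{x, y} \<in> C" "{y, z} \<in> C" "x \<noteq> z"
  obtains w where "distinct [x, y, z, w]" "C = {{x, y}, {y, z}, {z, w}, {w, x}}"
proof -
  obtain a b c d where d: "distinct [a, b, c, d]" and C: "C = {{a, b}, {b, c}, {c, d}, {d, a}}"
    using assms(1) unfolding four_cycle_def by blast
  have "y = a \<or> y = b \<or> y = c \<or> y = d" using assms(2) C by auto
  then have "\<exists>p q r. distinct [y, p, q, r] \<and> C = {{y, p}, {p, q}, {q, r}, {r, y}}"
  proof (elim disjE)
    assume "y = a"
    then show ?thesis using d C by blast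
  next
    assume "y = b"
    moreover have "C = {{b, c}, {c, d}, {d, a}, {a, b}}" using C by (simp only: insert_commute)
    moreover have "distinct [b, c, d, a]" using d by auto
    ultimately show ?thesis by blast
  next
    assume "y = c"
    moreover have "C = {{c, d}, {d, a}, {a, b}, {b, c}}" using C by (simp only: insert_commute)
    moreover have "distinct [c, d, a, b]" using d by auto
    ultimately show ?thesis by blast
  next
    assume "y = d"
    moreover have "C = {{d, a}, {a, b}, {b, c}, {c, d}}" using C by (simp only: insert_commute)
    moreover have "distinct [d, a, b, c]" using d by auto
    ultimately show ?thesis by blast
  qed
  then obtain p q r where y: "distinct [y, p, q, r]" and Cy: "C = {{y, p}, {p, q}, {q, r}, {r, y}}"
    by blast
  have nbr: "u = p \<or> u = r" if "{u, y} \<in> C" for u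
    using that y unfolding Cy by (auto simp: doubleton_eq_iff)
  have "x = p \<or> x = r" "z = p \<or> z = r"
    using nbr[of x] nbr[of z] assms(2,3) by (simp_all add: insert_commute)
  then consider "x = p" "z = r" | "x = r" "z = p" using assms(4) by blast
  then show ?thesis
  proof cases
    case 1
    have "C = {{x, y}, {y, z}, {z, q}, {q, x}}" unfolding Cy 1 by (simp only: insert_commute)
    moreover have "distinct [x, y, z, q]" using y 1 by auto
    ultimately show ?thesis using that by blast
  next
    case 2
    have "C = {{x, y}, {y, z}, {z, q}, {q, x}}" unfolding Cy 2 by (simp only: insert_commute)
    moreover have "distinct [x, y, z, q]" using y 2 by auto
    ultimately show ?thesis using that by blast
  qed
qed

context adinkra
begin

text \<open>Facts about columns of the matrices (pairings of fermions) follow from those about rows.\<close>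

lemma adinkra_swap: "adinkra V E \<mu> N fermions bosons color h"
proof
  show "fermions \<union> bosons = V" "fermions \<inter> bosons = {}"
    using bipartition by auto
  show "\<exists>b\<in>fermions. \<exists>f\<in>bosons. e = {b, f}" if "e \<in> E" for e
    using bipartite[OF that] by (metis insert_commute)
qed (fact N_pos nonempty color one_edge_of_each_color bicolor_cycles bicolor_odd height)+

lemma edge_of_color_unique:
  assumes "{u, v} \<in> E" "{u, w} \<in> E" "color {u, v} = color {u, w}"
  shows "v = w"
proof -
  have "u \<in> V" using edges assms(1) by (auto simp: doubleton_eq_iff)
  then have "\<exists>!e. e \<in> E \<and> u \<in> e \<and> color e = color {u, v}"
    using one_edge_of_each_color color[OF assms(1)] by simp
  moreover have "u \<in> {u, v}" "u \<in> {u, w}" by auto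
  ultimately have "{u, v} = {u, w}" using assms by metis
  then show ?thesis by (auto simp: doubleton_eq_iff)
qed

lemma ex_neighbor:
  assumes "b \<in> bosons" "c \<in> {1..N}"
  obtains f where "f \<in> fermions" "{b, f} \<in> E" "color {b, f} = c"
proof -
  have "b \<in> V" using assms bipartition by auto
  then obtain e where e: "e \<in> E" "b \<in> e" "color e = c"
    using one_edge_of_each_color assms(2) by blast
  then obtain f where "f \<in> fermions" "e = {b, f}"
    using bipartite[OF e(1)] assms(1) bipartition(2) by auto
  then show ?thesis using that e by blast
qed

text \<open>Two edges of colours c and d that meet in f lie in the same 4-cycle, because distinct cycles are
  disjoint. In this cycle the colours alternate, as no vertex has two edges of the same colour. An
  odd number of signs -1 among four makes the product of the four signs -1, so the two products
  over the opposite corners f and g cancel.\<close>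

lemma bicolor_square:
  assumes cd: "c \<in> {1..N}" "d \<in> {1..N}" "c \<noteq> d"
    and bf: "{b, f} \<in> E" "color {b, f} = c" and b'f: "{b', f} \<in> E" "color {b', f} = d"
  obtains g where "{b, g} \<in> E" "color {b, g} = d" "{b', g} \<in> E" "color {b', g} = c"
    "\<mu> {b, f} * \<mu> {b', f} + \<mu> {b, g} * \<mu> {b', g} = 0"
proof -
  obtain \<C> where cycles: "\<And>C. C \<in> \<C> \<Longrightarrow> four_cycle C" and
    disj: "pairwise (\<lambda>C C'. disjnt (\<Union>C) (\<Union>C')) \<C>" and
    union: "bicolor_edges E color c d = \<Union>\<C>"
    using bicolor_cycles[OF cd] unfolding disjoint_union_of_four_cycles_def by blast
  have fb': "{f, b'} = {b', f}" by auto
  have "{b, f} \<in> \<Union>\<C>" "{f, b'} \<in> \<Union>\<C>"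
    using bf b'f unfolding union[symmetric] bicolor_edges_def fb' by auto
  then obtain C C' where C: "C \<in> \<C>" "{b, f} \<in> C" "C' \<in> \<C>" "{f, b'} \<in> C'" by blast
  have "f \<in> \<Union>C" "f \<in> \<Union>C'" using C by auto
  then have "C' = C" using disj C unfolding pairwise_def disjnt_def by blast
  moreover have "b \<noteq> b'" using bf b'f cd(3) by auto
  ultimately obtain g where dist: "distinct [b, f, b', g]"
    and C_eq: "C = {{b, f}, {f, b'}, {b', g}, {g, b}}"
    using four_cycle_through_path[OF cycles[OF C(1)] C(2)] C(4) by blast
  have sub: "C \<subseteq> bicolor_edges E color c d" using C(1) union by auto
  have E: "{b, g} \<in> E" "{b', g} \<in> E"
    using sub C_eq by (auto simp: bicolor_edges_def insert_commute)
  have "color {b, g} = c \<or> color {b, g} = d" "color {b', g} = c \<or> color {b', g} = d"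
    using sub C_eq by (auto simp: bicolor_edges_def insert_commute)
  moreover have "color {b, g} \<noteq> c"
    using edge_of_color_unique[OF bf(1) E(1)] bf(2) dist by auto
  moreover have "color {b', g} \<noteq> d"
    using edge_of_color_unique[OF b'f(1) E(2)] b'f(2) dist by auto
  ultimately have col: "color {b, g} = d" "color {b', g} = c" by auto
  have odd: "odd (card {e \<in> C. \<mu> e = -1})"
    using bicolor_odd[OF cd cycles[OF C(1)] sub] .
  have C_eq': "C = {{b, f}, {b', f}, {b', g}, {b, g}}"
    using C_eq by (auto simp: insert_commute)
  have card: "card {e \<in> C. \<mu> e = -1} =
    (\<Sum>e\<in>C. if \<mu> e = -1 then 1 else 0)"
    unfolding card_eq_sum by (rule sum.inter_filter) (simp add: C_eq')
  have "\<mu> {b, f} \<in> {-1, 1}" "\<mu> {b', f} \<in> {-1, 1}" "\<mu> {b', g} \<in> {-1, 1}" "\<mu> {b, g} \<in> {-1, 1}"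
    using signature bf b'f E by auto
  moreover have "(\<Sum>e\<in>C. if \<mu> e = -1 then 1 else 0) = (if \<mu> {b, f} = -1 then 1 else 0)
      + (if \<mu> {b', f} = -1 then 1 else 0) + (if \<mu> {b', g} = -1 then 1 else 0)
      + (if \<mu> {b, g} = -1 then 1 else (0::nat))"
  proof -
    have "{b, f} \<notin> {{b', f}, {b', g}, {b, g}}" "{b', f} \<notin> {{b', g}, {b, g}}" "{b', g} \<notin> {{b, g}}"
      using dist by (auto simp: doubleton_eq_iff)
    then show ?thesis unfolding C_eq' by (simp del: insert_iff)
  qed
  ultimately have "\<mu> {b, f} * \<mu> {b', f} + \<mu> {b, g} * \<mu> {b', g} = 0"
    using odd unfolding card by (auto split: if_splits)
  then show ?thesis using that E col by blast
qed

definition edge_sign :: "'v \<Rightarrow> 'v \<Rightarrow> int" where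
  "edge_sign u v = (if {u, v} \<in> E then \<mu> {u, v} else 0)"

definition color_sign :: "nat \<Rightarrow> 'v \<Rightarrow> 'v \<Rightarrow> int" where
  "color_sign c u v = (if {u, v} \<in> E \<and> color {u, v} = c then \<mu> {u, v} else 0)"

text \<open>The entry at (b, b') of S_c S_d^T, where S_c is the signed incidence matrix of colour c.\<close>

definition color_pairing :: "nat \<Rightarrow> nat \<Rightarrow> 'v \<Rightarrow> 'v \<Rightarrow> int" where
  "color_pairing c d b b' = (\<Sum>f\<in>fermions. color_sign c b f * color_sign d b' f)"

lemma edge_sign_eq_sum_color_sign: "edge_sign u v = (\<Sum>c\<in>{1..N}. color_sign c u v)"
proof (cases "{u, v} \<in> E")
  case True
  then have "(\<Sum>c\<in>{1..N}. color_sign c u v) =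
    (\<Sum>c\<in>{1..N}. if c = color {u, v} then \<mu> {u, v} else 0)"
    by (intro sum.cong) (auto simp: color_sign_def)
  then show ?thesis using True color by (auto simp: edge_sign_def)
qed (simp add: edge_sign_def color_sign_def)

text \<open>Only the neighbour of b along colour c contributes to the sum.\<close>

lemma color_pairing_eq:
  assumes f: "f \<in> fermions" "{b, f} \<in> E" "color {b, f} = c"
  shows "color_pairing c d b b' = \<mu> {b, f} * color_sign d b' f"
proof -
  have "color_sign c b g = 0" if "g \<noteq> f" for g
    using edge_of_color_unique[OF f(2), of g] f(3) that by (auto simp: color_sign_def)
  then have "color_pairing c d b b' =
    (\<Sum>g\<in>fermions. if g = f then \<mu> {b, f} * color_sign d b' f else 0)"
    unfolding color_pairing_def using f by (intro sum.cong) (auto simp: color_sign_def)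
  moreover have "finite fermions"
    using finite_vertices bipartition(1) by (metis finite_Un)
  ultimately show ?thesis using f(1) by simp
qed

lemma color_pairing_same:
  assumes "b \<in> bosons" "c \<in> {1..N}"
  shows "color_pairing c c b b' = (if b = b' then 1 else 0)"
proof -
  obtain f where f: "f \<in> fermions" "{b, f} \<in> E" "color {b, f} = c"
    using ex_neighbor[OF assms] .
  have "\<mu> {b, f} * \<mu> {b, f} = 1" using signature[OF f(2)] by auto
  moreover have "color_sign c b' f = 0" if "b \<noteq> b'"
    using edge_of_color_unique[of f b b'] f that
    by (auto simp: color_sign_def insert_commute)
  ultimately show ?thesis
    using f by (auto simp: color_pairing_eq[OF f] color_sign_def)
qed

text \<open>If the first pairing is nonzero, then b and b' are joined by a path of colours c and d, the fourth
  vertex of the bicolor cycle gives the only term of the second pairing, and the odd number of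
  dashed edges makes the two cancel. Otherwise the same argument applies with c and d exchanged.\<close>

lemma color_pairing_anticommute:
  assumes b: "b \<in> bosons" "b' \<in> bosons" and cd: "c \<in> {1..N}" "d \<in> {1..N}" "c \<noteq> d"
  shows "color_pairing c d b b' + color_pairing d c b b' = 0"
proof -
  have *: "color_pairing c d b b' + color_pairing d c b b' = 0"
    if cd: "c \<in> {1..N}" "d \<in> {1..N}" "c \<noteq> d" and nz: "color_pairing c d b b' \<noteq> 0" for c d
  proof -
    obtain f where f: "f \<in> fermions" "{b, f} \<in> E" "color {b, f} = c"
      using ex_neighbor[OF b(1) cd(1)] .
    have b'f: "{b', f} \<in> E" "color {b', f} = d"
      using nz by (auto simp: color_pairing_eq[OF f] color_sign_def split: if_splits)
    obtain g where g: "{b, g} \<in> E" "color {b, g} = d" "{b', g} \<in> E" "color {b', g} = c"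
      "\<mu> {b, f} * \<mu> {b', f} + \<mu> {b, g} * \<mu> {b', g} = 0"
      using bicolor_square[OF cd f(2,3) b'f] .
    have "g \<in> fermions"
      using bipartite[OF g(1)] b(1) bipartition(2) by (auto simp: doubleton_eq_iff)
    then show ?thesis
      using g b'f by (simp add: color_pairing_eq[OF f] color_pairing_eq[OF _ g(1,2)] color_sign_def)
  qed
  show ?thesis
    using *[OF cd] *[of d c] cd by (cases "color_pairing c d b b' = 0") (auto simp: add.commute)
qed

lemma color_pairing_sym_sum:
  assumes "b \<in> bosons" "b' \<in> bosons" "c \<in> {1..N}" "d \<in> {1..N}"
  shows "color_pairing c d b b' + color_pairing d c b b' = (if c = d \<and> b = b' then 2 else 0)"
  using color_pairing_anticommute[OF assms] color_pairing_same[of b c b'] assms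
  by (cases "c = d") auto

lemma sum_color_sign_edge_sign:
  assumes "b \<in> bosons" "b' \<in> bosons" "c \<in> {1..N}"
  shows "(\<Sum>f\<in>fermions. color_sign c b f * edge_sign b' f)
       + (\<Sum>f\<in>fermions. edge_sign b f * color_sign c b' f) = (if b = b' then 2 else 0)"
proof -
  have "(\<Sum>f\<in>fermions. color_sign c b f * edge_sign b' f) = (\<Sum>d\<in>{1..N}. color_pairing c d b b')"
    unfolding color_pairing_def edge_sign_eq_sum_color_sign sum_distrib_left
    by (rule sum.swap)
  moreover have "(\<Sum>f\<in>fermions. edge_sign b f * color_sign c b' f) = (\<Sum>d\<in>{1..N}. color_pairing d c b b')"
    unfolding color_pairing_def edge_sign_eq_sum_color_sign sum_distrib_right
    by (rule sum.swap)
  ultimately have "(\<Sum>f\<in>fermions. color_sign c b f * edge_sign b' f)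
       + (\<Sum>f\<in>fermions. edge_sign b f * color_sign c b' f)
       = (\<Sum>d\<in>{1..N}. color_pairing c d b b' + color_pairing d c b b')"
    by (simp add: sum.distrib)
  also have "\<dots> = (\<Sum>d\<in>{1..N}. if d = c then if b = b' then 2 else 0 else 0)"
    using assms by (intro sum.cong) (auto simp: color_pairing_sym_sum)
  finally show ?thesis using assms(3) by simp
qed

text \<open>Expanding into colours gives all pairings of c and d. Adding the same expansion with c and d
  exchanged leaves only the terms with c = d.\<close>

lemma sum_edge_sign_edge_sign:
  assumes "b \<in> bosons" "b' \<in> bosons"
  shows "(\<Sum>f\<in>fermions. edge_sign b f * edge_sign b' f) = (if b = b' then int N else 0)"
proof -
  have eq: "(\<Sum>f\<in>fermions. edge_sign b f * edge_sign b' f)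
      = (\<Sum>c\<in>{1..N}. \<Sum>f\<in>fermions. color_sign c b f * edge_sign b' f)"
    unfolding edge_sign_eq_sum_color_sign[of b] sum_distrib_right by (rule sum.swap)
  have eq': "(\<Sum>f\<in>fermions. edge_sign b f * edge_sign b' f)
      = (\<Sum>c\<in>{1..N}. \<Sum>f\<in>fermions. edge_sign b f * color_sign c b' f)"
    unfolding edge_sign_eq_sum_color_sign[of b'] sum_distrib_left by (rule sum.swap)
  have "2 * (\<Sum>f\<in>fermions. edge_sign b f * edge_sign b' f)
      = (\<Sum>c\<in>{1..N}. (\<Sum>f\<in>fermions. color_sign c b f * edge_sign b' f)
          + (\<Sum>f\<in>fermions. edge_sign b f * color_sign c b' f))"
    unfolding sum.distrib using eq eq' by simp
  also have "\<dots> = (\<Sum>c\<in>{1..N}. if b = b' then 2 else 0)"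
    using assms by (intro sum.cong) (auto simp: sum_color_sign_edge_sign)
  finally show ?thesis by (auto split: if_splits)
qed

definition color_mat :: "nat \<Rightarrow> 'v list \<Rightarrow> 'v list \<Rightarrow> int mat" where
  "color_mat c bs fs = mat (length bs) (length fs) (\<lambda>(i, j). color_sign c (bs ! i) (fs ! j))"

lemma sum_nth_distinct:
  fixes g :: "'v \<Rightarrow> int"
  assumes "distinct xs"
  shows "(\<Sum>j = 0..<length xs. g (xs ! j)) = (\<Sum>x\<in>set xs. g x)"
  using sum.reindex_bij_betw[OF bij_betw_nth[OF assms refl refl], of g]
  by (simp add: atLeast0LessThan)

lemma mat_mult_transpose_entry:
  fixes p q :: "'v \<Rightarrow> 'v \<Rightarrow> int"
  assumes "distinct fs" "i < length bs" "k < length bs"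
  shows "(mat (length bs) (length fs) (\<lambda>(i, j). p (bs ! i) (fs ! j))
      * transpose_mat (mat (length bs) (length fs) (\<lambda>(i, j). q (bs ! i) (fs ! j)))) $$ (i, k)
    = (\<Sum>f\<in>set fs. p (bs ! i) f * q (bs ! k) f)"
  using assms sum_nth_distinct[OF assms(1), of "\<lambda>f. p (bs ! i) f * q (bs ! k) f"]
  by (simp add: scalar_prod_def)

text \<open>Colour 1 is chosen because it is present for every N \<ge> 1; any fixed colour would do.\<close>

lemma matrix_relations:
  assumes bs: "distinct bs" "set bs = bosons" and fs: "distinct fs" "set fs = fermions"
  defines "X \<equiv> boson_fermion_mat E \<mu> bs fs" and "S \<equiv> color_mat 1 bs fs" and "n \<equiv> length bs"
  shows "X \<in> carrier_mat n n" "S \<in> carrier_mat n n"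
    "S * transpose_mat S = 1\<^sub>m n"
    "X * transpose_mat X = int N \<cdot>\<^sub>m 1\<^sub>m n"
    "S * transpose_mat X + X * transpose_mat S = 2 \<cdot>\<^sub>m 1\<^sub>m n"
proof -
  have n: "length fs = n"
    using card_bosons_eq_card_fermions bs fs distinct_card by (metis n_def)
  have X: "X = mat (length bs) (length fs) (\<lambda>(i, j). edge_sign (bs ! i) (fs ! j))"
    unfolding X_def boson_fermion_mat_def edge_sign_def by simp
  show c: "X \<in> carrier_mat n n" "S \<in> carrier_mat n n"
    using n by (auto simp: X S_def color_mat_def n_def)
  note dims = c carrier_matD[OF c(1)] carrier_matD[OF c(2)]
  have 1: "(1::nat) \<in> {1..N}" using N_pos by simp
  have in_bs: "bs ! i \<in> bosons" if "i < n" for i using that bs by (auto simp: n_def)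
  have eq_iff: "bs ! i = bs ! k \<longleftrightarrow> i = k" if "i < n" "k < n" for i k
    using that bs(1) by (simp add: n_def nth_eq_iff_index_eq)
  note entry = mat_mult_transpose_entry[OF fs(1), of _ bs, unfolded fs(2) n_def[symmetric]]
  show "S * transpose_mat S = 1\<^sub>m n"
  proof (rule eq_matI)
    fix i k assume "i < dim_row (1\<^sub>m n :: int mat)" "k < dim_col (1\<^sub>m n :: int mat)"
    then have ik: "i < n" "k < n" by auto
    show "(S * transpose_mat S) $$ (i, k) = 1\<^sub>m n $$ (i, k)"
      using entry[OF ik] color_pairing_same[OF in_bs[OF ik(1)] 1, of "bs ! k"] eq_iff[OF ik] ik
      by (simp add: S_def color_mat_def color_pairing_def n_def)
  qed (use dims in auto)
  show "X * transpose_mat X = int N \<cdot>\<^sub>m 1\<^sub>m n"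
  proof (rule eq_matI)
    fix i k assume "i < dim_row (int N \<cdot>\<^sub>m 1\<^sub>m n :: int mat)" "k < dim_col (int N \<cdot>\<^sub>m 1\<^sub>m n :: int mat)"
    then have ik: "i < n" "k < n" by auto
    show "(X * transpose_mat X) $$ (i, k) = (int N \<cdot>\<^sub>m 1\<^sub>m n) $$ (i, k)"
      using entry[OF ik] sum_edge_sign_edge_sign[OF in_bs[OF ik(1)] in_bs[OF ik(2)]] eq_iff[OF ik] ik
      by (simp add: X n_def)
  qed (use dims in auto)
  show "S * transpose_mat X + X * transpose_mat S = 2 \<cdot>\<^sub>m 1\<^sub>m n"
  proof (rule eq_matI)
    fix i k assume "i < dim_row (2 \<cdot>\<^sub>m 1\<^sub>m n :: int mat)" "k < dim_col (2 \<cdot>\<^sub>m 1\<^sub>m n :: int mat)"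
    then have ik: "i < n" "k < n" by auto
    have "(S * transpose_mat X) $$ (i, k) = (\<Sum>f\<in>fermions. color_sign 1 (bs ! i) f * edge_sign (bs ! k) f)"
      using entry[OF ik] by (simp add: X S_def color_mat_def n_def)
    moreover have "(X * transpose_mat S) $$ (i, k) = (\<Sum>f\<in>fermions. edge_sign (bs ! i) f * color_sign 1 (bs ! k) f)"
      using entry[OF ik] by (simp add: X S_def color_mat_def n_def)
    moreover have "(S * transpose_mat X + X * transpose_mat S) $$ (i, k)
        = (S * transpose_mat X) $$ (i, k) + (X * transpose_mat S) $$ (i, k)"
      using ik dims by simp
    ultimately show "(S * transpose_mat X + X * transpose_mat S) $$ (i, k) = (2 \<cdot>\<^sub>m 1\<^sub>m n) $$ (i, k)"
      using sum_color_sign_edge_sign[OF in_bs[OF ik(1)] in_bs[OF ik(2)] 1] eq_iff[OF ik] ik by simp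
  qed (use dims in auto)
qed

lemma matrix_relations_transposed:
  assumes bs: "distinct bs" "set bs = bosons" and fs: "distinct fs" "set fs = fermions"
  defines "X \<equiv> boson_fermion_mat E \<mu> bs fs" and "S \<equiv> color_mat 1 bs fs" and "n \<equiv> length bs"
  shows "transpose_mat S * S = 1\<^sub>m n" "transpose_mat X * X = int N \<cdot>\<^sub>m 1\<^sub>m n"
proof -
  interpret swapped: adinkra V E \<mu> N fermions bosons color h by (rule adinkra_swap)
  have n: "length fs = n"
    using card_bosons_eq_card_fermions bs fs distinct_card by (metis n_def)
  have "boson_fermion_mat E \<mu> fs bs = transpose_mat X"
    by (rule eq_matI) (auto simp: X_def boson_fermion_mat_def insert_commute)
  moreover have "color_mat 1 fs bs = transpose_mat S"
    by (rule eq_matI) (auto simp: S_def color_mat_def color_sign_def insert_commute)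
  ultimately show "transpose_mat S * S = 1\<^sub>m n" "transpose_mat X * X = int N \<cdot>\<^sub>m 1\<^sub>m n"
    using swapped.matrix_relations[OF fs bs] n by simp_all
qed

end

section \<open>Auxiliary facts on powers of two, scalar multiples and lists\<close>

lemma power_of_two_if_dvd_power:
  fixes d :: int
  assumes "d dvd 2 ^ m" "0 \<le> d"
  shows "\<exists>k. d = 2 ^ k"
  using divides_primepow[of 2 d m] assms by auto

lemma power_of_two_if_prime_divisors:
  fixes d :: int
  assumes "0 < d" "\<And>p. prime p \<Longrightarrow> p dvd d \<Longrightarrow> p = 2"
  shows "\<exists>k. d = 2 ^ k"
proof -
  obtain m where m: "d = 2 ^ multiplicity 2 d * m" "\<not> 2 dvd m"
    using multiplicity_decompose'[of d 2] assms(1) by auto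
  have "is_unit m"
  proof (rule ccontr)
    assume "\<not> is_unit m"
    then obtain p where "prime p" "p dvd m"
      using prime_divisor_exists[of m] m assms(1) by auto
    then show False using assms(2)[of p] m by (metis dvd_mult)
  qed
  moreover have "0 < m" using m(1) assms(1) by (metis zero_less_mult_pos zero_less_numeral zero_less_power)
  ultimately show ?thesis using m(1) by auto
qed

lemma transpose_mat_smult: "transpose_mat (a \<cdot>\<^sub>m A) = a \<cdot>\<^sub>m transpose_mat A"
  by (rule eq_matI) auto

lemma smult_smult_mat: "a \<cdot>\<^sub>m (b \<cdot>\<^sub>m A) = (a * b) \<cdot>\<^sub>m (A :: int mat)"
  by (rule eq_matI) auto

lemma ball_set_take_drop:
  assumes "\<And>i. i < length xs \<Longrightarrow> i < k \<Longrightarrow> P (xs ! i)"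
    and "\<And>i. i < length xs \<Longrightarrow> k \<le> i \<Longrightarrow> Q (xs ! i)"
  shows "(\<forall>x\<in>set (take k xs). P x) \<and> (\<forall>x\<in>set (drop k xs). Q x)"
  using assms by (auto simp: in_set_conv_nth)

section \<open>Invariant factors of \<open>X\<close>\<close>

locale adinkra_matrices =
  fixes n N :: nat and X S :: "int mat"
  assumes X: "X \<in> carrier_mat n n" and S: "S \<in> carrier_mat n n" and N_pos: "N \<ge> 1"
    and S_orthogonal: "S * transpose_mat S = 1\<^sub>m n" "transpose_mat S * S = 1\<^sub>m n"
    and X_orthogonal: "X * transpose_mat X = int N \<cdot>\<^sub>m 1\<^sub>m n" "transpose_mat X * X = int N \<cdot>\<^sub>m 1\<^sub>m n"
    and S_X: "S * transpose_mat X + X * transpose_mat S = 2 \<cdot>\<^sub>m 1\<^sub>m n"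
begin

lemma S_inverse: "inverse_mats n S (transpose_mat S)"
  using S S_orthogonal by (simp add: inverse_mats_def)

text \<open>This is S X^T + X S^T = 2 I multiplied by S. It writes the simple matrix 2 S as a sum of two
  matrices with the Smith Normal Form of X.\<close>

lemma X_reflection: "X + S * transpose_mat X * S = 2 \<cdot>\<^sub>m S"
proof -
  have "(S * transpose_mat X + X * transpose_mat S) * S = S * transpose_mat X * S + X * (transpose_mat S * S)"
    using X S by (simp add: add_mult_distrib_mat[of _ n n _ _ n] assoc_mult_mat[of _ n n _ n _ n])
  then have "2 \<cdot>\<^sub>m S = S * transpose_mat X * S + X"
    using X S by (simp add: S_X S_orthogonal mult_smult_assoc_mat[of _ n n _ n])
  then show ?thesis
    using X S comm_add_mat[of X n n "S * transpose_mat X * S"] by simp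
qed

lemma X_reflection_transposed:
  "transpose_mat X + transpose_mat S * X * transpose_mat S = 2 \<cdot>\<^sub>m transpose_mat S"
proof -
  have "transpose_mat (S * transpose_mat X * S) = transpose_mat S * X * transpose_mat S"
    using X S by (simp add: transpose_mult[of _ n n _ n] assoc_mult_mat[of _ n n _ n _ n])
  then show ?thesis
    using arg_cong[OF X_reflection, of transpose_mat] X S
    by (simp add: transpose_add[of _ n n] transpose_mat_smult)
qed

text \<open>The lower half divides det (X + S X^T S) = det (2 S), which is a power of 2 up to sign.\<close>

lemma invariant_factors_X:
  assumes D: "smith_diagonal n D" "equivalent_mats n X D"
  shows "\<And>i. 2 * i < n \<Longrightarrow> \<exists>k. D $$ (i, i) = 2 ^ k"
    "\<And>i. i < n \<Longrightarrow> D $$ (i, i) * D $$ (n - 1 - i, n - 1 - i) = int N"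
proof -
  interpret smith_diagonal n D by fact
  have Xt: "equivalent_mats n (transpose_mat X) D"
    using equivalent_mats_transpose[OF D(2)] transpose_eq by simp
  have "equivalent_mats n (S * transpose_mat X * S) (transpose_mat X)"
    using X S_inverse by (intro equivalent_mats_sym[OF equivalent_matsI[of _ n S _ S]]) auto
  then have B: "equivalent_mats n (S * transpose_mat X * S) D"
    using Xt by (rule equivalent_mats_trans)
  show "\<exists>k. D $$ (i, i) = 2 ^ k" if i: "2 * i < n" for i
  proof -
    have "D $$ (i, i) dvd det (X + S * transpose_mat X * S)"
      by (rule lower_half_dvd_det_sum[OF D(2) B i])
    also have "\<dots> = 2 ^ n * det S" unfolding X_reflection using S by simp
    also have "\<dots> dvd 2 ^ n * 1"
      using inverse_mats_det_unit[OF S_inverse] by (intro mult_dvd_mono) auto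
    finally show ?thesis using nonneg[of i] i by (intro power_of_two_if_dvd_power[of _ n]) auto
  qed
  show "D $$ (i, i) * D $$ (n - 1 - i, n - 1 - i) = int N" if "i < n" for i
    using mult_complementary[OF D(2) Xt X_orthogonal(1) _ that] by simp
qed

section \<open>Invariant factors of the signed Laplacian\<close>

lemma mult_blocks:
  assumes "A \<in> carrier_mat n n" "B \<in> carrier_mat n n" "C \<in> carrier_mat n n" "D \<in> carrier_mat n n"
    "A' \<in> carrier_mat n n" "B' \<in> carrier_mat n n" "C' \<in> carrier_mat n n" "D' \<in> carrier_mat n n"
  shows "four_block_mat A B C D * four_block_mat A' B' C' D' =
    four_block_mat (A * A' + B * C') (A * B' + B * D') (C * A' + D * C') (C * B' + D * D')"
  using assms by (rule mult_four_block_mat)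

lemmas smult_mult = mult_smult_distrib[of _ n n _ n] mult_smult_assoc_mat[of _ n n _ n]
  smult_smult_mat assoc_mult_mat[of _ n n _ n _ n]

text \<open>Conjugation by this matrix changes the signs of all fermions. It turns N I - A into N I + A.\<close>

definition "fermion_sign_mat = four_block_mat (1\<^sub>m n) (0\<^sub>m n n) (0\<^sub>m n n) (- 1 \<cdot>\<^sub>m 1\<^sub>m n :: int mat)"

text \<open>The signed adjacency matrix of the edges of colour 1: a signed permutation matrix that moves
  every vertex along its edge of that colour, and so exchanges bosons and fermions.\<close>

definition "color_swap_mat = four_block_mat (0\<^sub>m n n) S (transpose_mat S) (0\<^sub>m n n)"

definition "shear_mat = four_block_mat (1\<^sub>m n) (0\<^sub>m n n) (transpose_mat X) (1\<^sub>m n)"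

text \<open>The result of adding X^T times the boson rows of L to its fermion rows, and likewise for columns.
  Its off-diagonal blocks and one diagonal block carry the factor N - 1, so that modulo N - 1
  only one diagonal block, N I, is left.\<close>

definition "sheared_laplacian =
  four_block_mat (int N \<cdot>\<^sub>m 1\<^sub>m n) ((int N - 1) \<cdot>\<^sub>m X)
    ((int N - 1) \<cdot>\<^sub>m transpose_mat X) (int N * (int N - 1) \<cdot>\<^sub>m 1\<^sub>m n)"

lemma scalar_blocks: "four_block_mat (a \<cdot>\<^sub>m 1\<^sub>m n) (0\<^sub>m n n) (0\<^sub>m n n) (a \<cdot>\<^sub>m 1\<^sub>m n)
    = (a :: int) \<cdot>\<^sub>m 1\<^sub>m (n + n)"
  by (rule eq_matI) auto

lemma fermion_sign_mat_inverse: "inverse_mats (n + n) fermion_sign_mat fermion_sign_mat"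
proof (rule inverse_mats_involution)
  have "fermion_sign_mat * fermion_sign_mat = four_block_mat (1 \<cdot>\<^sub>m 1\<^sub>m n) (0\<^sub>m n n) (0\<^sub>m n n) (1 \<cdot>\<^sub>m 1\<^sub>m n)"
    unfolding fermion_sign_mat_def
    by (subst mult_blocks) (auto simp: smult_mult intro!: cong_four_block_mat eq_matI)
  then show "fermion_sign_mat * fermion_sign_mat = 1\<^sub>m (n + n)" unfolding scalar_blocks by (auto intro: eq_matI)
qed (simp add: fermion_sign_mat_def)

lemma color_swap_mat_inverse: "inverse_mats (n + n) color_swap_mat color_swap_mat"
proof (rule inverse_mats_involution)
  have "color_swap_mat * color_swap_mat = four_block_mat (1 \<cdot>\<^sub>m 1\<^sub>m n) (0\<^sub>m n n) (0\<^sub>m n n) (1 \<cdot>\<^sub>m 1\<^sub>m n)"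
    unfolding color_swap_mat_def using S S_orthogonal
    by (subst mult_blocks) (auto intro!: cong_four_block_mat eq_matI)
  then show "color_swap_mat * color_swap_mat = 1\<^sub>m (n + n)" unfolding scalar_blocks by (auto intro: eq_matI)
qed (use S in \<open>simp add: color_swap_mat_def\<close>)

lemma shear_mat_inverse:
  "inverse_mats (n + n) shear_mat (four_block_mat (1\<^sub>m n) (0\<^sub>m n n) (- transpose_mat X) (1\<^sub>m n))"
proof -
  let ?T = "four_block_mat (1\<^sub>m n) (0\<^sub>m n n) (- transpose_mat X) (1\<^sub>m n)"
  have "shear_mat * ?T = four_block_mat (1 \<cdot>\<^sub>m 1\<^sub>m n) (0\<^sub>m n n) (0\<^sub>m n n) (1 \<cdot>\<^sub>m 1\<^sub>m n)"
    unfolding shear_mat_def using X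
    by (subst mult_blocks) (auto intro!: cong_four_block_mat eq_matI)
  moreover have "?T * shear_mat = four_block_mat (1 \<cdot>\<^sub>m 1\<^sub>m n) (0\<^sub>m n n) (0\<^sub>m n n) (1 \<cdot>\<^sub>m 1\<^sub>m n)"
    unfolding shear_mat_def using X
    by (subst mult_blocks) (auto intro!: cong_four_block_mat eq_matI)
  moreover have "1 \<cdot>\<^sub>m 1\<^sub>m (n + n) = (1\<^sub>m (n + n) :: int mat)" by (auto intro: eq_matI)
  ultimately show ?thesis
    unfolding scalar_blocks using X by (simp add: inverse_mats_def shear_mat_def)
qed

lemma laplacian_blocks:
  "signed_laplacian N X = four_block_mat (int N \<cdot>\<^sub>m 1\<^sub>m n) (- X) (- transpose_mat X) (int N \<cdot>\<^sub>m 1\<^sub>m n)"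
  using X by (simp add: signed_laplacian_block)

lemma laplacian_sign_conjugate:
  "fermion_sign_mat * signed_laplacian N X * fermion_sign_mat
    = four_block_mat (int N \<cdot>\<^sub>m 1\<^sub>m n) X (transpose_mat X) (int N \<cdot>\<^sub>m 1\<^sub>m n)"
  unfolding laplacian_blocks fermion_sign_mat_def using X
  by (subst mult_blocks, auto simp: smult_mult)
    (subst mult_blocks, auto simp: smult_mult intro!: cong_four_block_mat eq_matI)

text \<open>(N I - A) (N I + A) = (N^2 - N) I, since A^2 = N I.\<close>

lemma laplacian_mult_sign_conjugate:
  "signed_laplacian N X * (fermion_sign_mat * signed_laplacian N X * fermion_sign_mat)
    = (int N * (int N - 1)) \<cdot>\<^sub>m 1\<^sub>m (n + n)"
  unfolding laplacian_sign_conjugate scalar_blocks[symmetric] unfolding laplacian_blocks using X X_orthogonal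
  by (subst mult_blocks)
    (auto simp: smult_mult algebra_simps intro!: cong_four_block_mat eq_matI)

lemma laplacian_add_sign_conjugate:
  "signed_laplacian N X + fermion_sign_mat * signed_laplacian N X * fermion_sign_mat = (2 * int N) \<cdot>\<^sub>m 1\<^sub>m (n + n)"
  unfolding laplacian_sign_conjugate scalar_blocks[symmetric] unfolding laplacian_blocks using X
  by (subst add_four_block_mat[of _ n n _ n _ n]) (auto intro!: cong_four_block_mat eq_matI)

lemma laplacian_shear:
  "shear_mat * signed_laplacian N X * transpose_mat shear_mat = sheared_laplacian"
proof -
  have t: "transpose_mat shear_mat = four_block_mat (1\<^sub>m n) X (0\<^sub>m n n) (1\<^sub>m n)"
    unfolding shear_mat_def using X by (subst transpose_four_block_mat) auto
  have "shear_mat * signed_laplacian N X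
    = four_block_mat (int N \<cdot>\<^sub>m 1\<^sub>m n) (- X) ((int N - 1) \<cdot>\<^sub>m transpose_mat X) (0\<^sub>m n n)"
    unfolding laplacian_blocks shear_mat_def using X X_orthogonal
    by (subst mult_blocks)
      (auto simp: smult_mult algebra_simps intro!: cong_four_block_mat eq_matI)
  then show ?thesis
    unfolding t sheared_laplacian_def using X X_orthogonal
    by simp (subst mult_blocks,
      auto simp: smult_mult algebra_simps intro!: cong_four_block_mat eq_matI)
qed

lemma sheared_laplacian_swap:
  "color_swap_mat * sheared_laplacian * color_swap_mat = four_block_mat (int N * (int N - 1) \<cdot>\<^sub>m 1\<^sub>m n)
    ((int N - 1) \<cdot>\<^sub>m (S * transpose_mat X * S)) ((int N - 1) \<cdot>\<^sub>m (transpose_mat S * X * transpose_mat S))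
    (int N \<cdot>\<^sub>m 1\<^sub>m n)"
proof -
  have "color_swap_mat * sheared_laplacian = four_block_mat ((int N - 1) \<cdot>\<^sub>m (S * transpose_mat X))
      ((int N * (int N - 1)) \<cdot>\<^sub>m S) (int N \<cdot>\<^sub>m transpose_mat S) ((int N - 1) \<cdot>\<^sub>m (transpose_mat S * X))"
    unfolding color_swap_mat_def sheared_laplacian_def using X S
    by (subst mult_blocks) (auto simp: smult_mult intro!: cong_four_block_mat)
  then show ?thesis
    unfolding color_swap_mat_def using X S S_orthogonal
    by simp (subst mult_blocks, auto simp: smult_mult intro!: cong_four_block_mat)
qed

text \<open>The swap exchanges the diagonal blocks N I and N (N - 1) I, whose sum is N^2 I, and in the
  off-diagonal blocks X + S X^T S = 2 S occurs. For odd N this sum is invertible modulo 2,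
  in contrast to the sum in \<open>laplacian_add_sign_conjugate\<close>.\<close>

lemma sheared_laplacian_swap_sum:
  "sheared_laplacian + color_swap_mat * sheared_laplacian * color_swap_mat = four_block_mat ((int N)\<^sup>2 \<cdot>\<^sub>m 1\<^sub>m n)
    (2 * (int N - 1) \<cdot>\<^sub>m S) (2 * (int N - 1) \<cdot>\<^sub>m transpose_mat S) ((int N)\<^sup>2 \<cdot>\<^sub>m 1\<^sub>m n)"
proof -
  have smult: "(int N - 1) \<cdot>\<^sub>m A + (int N - 1) \<cdot>\<^sub>m B = 2 * (int N - 1) \<cdot>\<^sub>m C"
    if "A \<in> carrier_mat n n" "B \<in> carrier_mat n n" "A + B = 2 \<cdot>\<^sub>m C" for A B C
    using add_smult_distrib_left_mat[OF that(1,2), of "int N - 1"] that(3)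
    by (simp only: smult_smult_mat mult.commute)
  note 1 = smult[OF _ _ X_reflection] and 2 = smult[OF _ _ X_reflection_transposed]
  show ?thesis
    unfolding sheared_laplacian_swap unfolding sheared_laplacian_def using X S 1 2
    by (subst add_four_block_mat[of _ n n _ n _ n])
      (auto simp: power2_eq_square algebra_simps intro!: cong_four_block_mat eq_matI[of "_ \<cdot>\<^sub>m 1\<^sub>m n + _"])
qed

text \<open>Multiplying N^2 I + 2 (N - 1) T by N^2 I - 2 (N - 1) T, with T the swap and T^2 = I, gives a scalar
  matrix. This bounds the determinant of the first factor without computing it.\<close>

lemma sheared_laplacian_swap_sum_norm:
  "(sheared_laplacian + color_swap_mat * sheared_laplacian * color_swap_mat) *
    four_block_mat ((int N)\<^sup>2 \<cdot>\<^sub>m 1\<^sub>m n) (- 2 * (int N - 1) \<cdot>\<^sub>m S)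
      (- 2 * (int N - 1) \<cdot>\<^sub>m transpose_mat S) ((int N)\<^sup>2 \<cdot>\<^sub>m 1\<^sub>m n)
    = ((int N) ^ 4 - 4 * (int N - 1)\<^sup>2) \<cdot>\<^sub>m 1\<^sub>m (n + n)"
  unfolding sheared_laplacian_swap_sum scalar_blocks[symmetric] using S S_orthogonal
  by (subst mult_blocks)
    (auto simp: smult_mult power2_eq_square power4_eq_xxxx algebra_simps intro!: cong_four_block_mat eq_matI)

text \<open>The lower half divides powers of 2 N and of N^4 - 4 (N - 1)^2. An odd prime dividing both would
  divide N and N - 1; the prime 2 divides the second number only if N is even. So the lower half
  consists of powers of 2, all equal to 1 if N is odd. If N is even, they are prime to N - 1
  and divide N (N - 1), hence N.\<close>

lemma invariant_factors_L:
  assumes D: "smith_diagonal (n + n) D" "equivalent_mats (n + n) (signed_laplacian N X) D"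
  shows "\<And>i. i < n \<Longrightarrow> \<exists>k. D $$ (i, i) = 2 ^ k"
    "\<And>i. i < n \<Longrightarrow> D $$ (i, i) dvd int N"
    "\<And>i. i < n + n \<Longrightarrow> D $$ (i, i) * D $$ (n + n - 1 - i, n + n - 1 - i) = int N * (int N - 1)"
proof -
  interpret smith_diagonal "n + n" D by fact
  let ?L = "signed_laplacian N X"
  have L: "?L \<in> carrier_mat (n + n) (n + n)" unfolding laplacian_blocks using X by simp
  have "equivalent_mats (n + n) (fermion_sign_mat * ?L * fermion_sign_mat) ?L"
    using L fermion_sign_mat_inverse by (intro equivalent_mats_sym[OF equivalent_matsI[of _ _ fermion_sign_mat _ fermion_sign_mat]]) auto
  then have sign_equiv: "equivalent_mats (n + n) (fermion_sign_mat * ?L * fermion_sign_mat) D"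
    using D(2) by (rule equivalent_mats_trans)
  have "equivalent_mats (n + n) sheared_laplacian ?L"
    using L shear_mat_inverse inverse_mats_transpose[OF shear_mat_inverse] laplacian_shear
    by (intro equivalent_mats_sym[OF equivalent_matsI[of _ _ shear_mat _ "transpose_mat shear_mat"]]) auto
  then have shear_equiv: "equivalent_mats (n + n) sheared_laplacian D"
    using D(2) by (rule equivalent_mats_trans)
  have K: "sheared_laplacian \<in> carrier_mat (n + n) (n + n)" unfolding sheared_laplacian_def using X by simp
  have "equivalent_mats (n + n) (color_swap_mat * sheared_laplacian * color_swap_mat) sheared_laplacian"
    using K color_swap_mat_inverse by (intro equivalent_mats_sym[OF equivalent_matsI[of _ _ color_swap_mat _ color_swap_mat]]) auto
  then have swap_equiv: "equivalent_mats (n + n) (color_swap_mat * sheared_laplacian * color_swap_mat) D"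
    using shear_equiv by (rule equivalent_mats_trans)
  show prod: "D $$ (i, i) * D $$ (n + n - 1 - i, n + n - 1 - i) = int N * (int N - 1)" if "i < n + n" for i
    using mult_complementary[OF D(2) sign_equiv laplacian_mult_sign_conjugate _ that] N_pos by simp
  have two_N: "D $$ (i, i) dvd (2 * int N) ^ (n + n)" if "i < n" for i
    using lower_half_dvd_det_sum[OF D(2) sign_equiv, of i] that unfolding laplacian_add_sign_conjugate by simp
  have norm: "D $$ (i, i) dvd ((int N) ^ 4 - 4 * (int N - 1)\<^sup>2) ^ (n + n)" if "i < n" for i
  proof -
    let ?M = "sheared_laplacian + color_swap_mat * sheared_laplacian * color_swap_mat"
    let ?M' = "four_block_mat ((int N)\<^sup>2 \<cdot>\<^sub>m 1\<^sub>m n) (- 2 * (int N - 1) \<cdot>\<^sub>m S)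
      (- 2 * (int N - 1) \<cdot>\<^sub>m transpose_mat S) ((int N)\<^sup>2 \<cdot>\<^sub>m 1\<^sub>m n)"
    have "D $$ (i, i) dvd det ?M"
      using lower_half_dvd_det_sum[OF shear_equiv swap_equiv, of i] that by simp
    also have "\<dots> dvd det ?M * det ?M'" by simp
    also have "\<dots> = det (?M * ?M')"
      using S by (intro det_mult[symmetric, of _ "n + n"]) (simp_all add: sheared_laplacian_swap_sum)
    finally show ?thesis unfolding sheared_laplacian_swap_sum_norm by simp
  qed
  have primes: "p = 2 \<and> even N" if i: "i < n" and p: "prime p" "p dvd D $$ (i, i)" for i and p :: int
  proof -
    have "p dvd (2 * int N) ^ (n + n)" "p dvd ((int N) ^ 4 - 4 * (int N - 1)\<^sup>2) ^ (n + n)"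
      using p two_N[OF i] norm[OF i] dvd_trans by blast+
    then have 1: "p dvd 2 * int N" and 2: "p dvd (int N) ^ 4 - 4 * (int N - 1)\<^sup>2"
      using p(1) prime_dvd_power by blast+
    show ?thesis
    proof (cases "p dvd int N")
      case True
      then have "p dvd (int N) ^ 4" by (rule dvd_trans) (simp add: dvd_power)
      then have "p dvd (int N) ^ 4 - ((int N) ^ 4 - 4 * (int N - 1)\<^sup>2)" using 2 by (rule dvd_diff)
      then have "p dvd 4 * (int N - 1)\<^sup>2" by simp
      moreover have "\<not> p dvd int N - 1"
      proof
        assume "p dvd int N - 1"
        then have "p dvd int N - (int N - 1)" using True by (rule dvd_diff[rotated])
        then have "p dvd 1" by (simp only: diff_diff_eq2) simp
        then show False using p(1) not_prime_unit by blast
      qed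
      ultimately have "p dvd 2 ^ 2"
        using prime_dvd_multD[OF p(1), of 4 "(int N - 1)\<^sup>2"] prime_dvd_power[OF p(1)] by auto
      then have "p dvd 2" using p(1) prime_dvd_power by blast
      then have "p = 2" using p(1) by (simp add: primes_dvd_imp_eq)
      then show ?thesis using True by simp
    next
      case False
      then have "p dvd 2" using 1 p(1) prime_dvd_multD by blast
      then have p2: "p = 2" using p(1) by (simp add: primes_dvd_imp_eq)
      have "even ((int N) ^ 4 - 4 * (int N - 1)\<^sup>2)" using 2 p2 by simp
      then have "even N" by simp
      then show ?thesis using p2 by simp
    qed
  qed
  show power: "\<exists>k. D $$ (i, i) = 2 ^ k" if i: "i < n" for i
  proof (rule power_of_two_if_prime_divisors)
    have "D $$ (i, i) \<noteq> 0" using two_N[OF i] N_pos by auto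
    then show "0 < D $$ (i, i)" using nonneg[of i] i by simp
  qed (use primes[OF i] in blast)
  show "D $$ (i, i) dvd int N" if i: "i < n" for i
  proof (cases "is_unit (D $$ (i, i))")
    case False
    obtain k where k: "D $$ (i, i) = 2 ^ k" using power[OF i] by blast
    then have "even (D $$ (i, i))" using False by (cases k) auto
    then have "even N" using primes[OF i, of 2] by simp
    then have "odd (int N - 1)" by simp
    then have "coprime (D $$ (i, i)) (int N - 1)" by (simp add: k)
    moreover have "D $$ (i, i) dvd int N * (int N - 1)" using prod[of i] i by (metis dvd_triv_left trans_less_add1)
    ultimately show ?thesis by (simp add: coprime_dvd_mult_left_iff)
  qed (simp add: unit_imp_dvd)
qed

end

section \<open>The invariant factors of an Adinkra\<close>

theorem theorem30:
  fixes V :: "'v set" and E :: "'v set set" and \<mu> :: "'v set \<Rightarrow> int"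
    and N :: nat and bosons fermions :: "'v set"
    and color :: "'v set \<Rightarrow> nat" and h :: "'v \<Rightarrow> int"
    and bs fs :: "'v list" and X L :: "int mat"
  assumes "adinkra V E \<mu> N bosons fermions color h"
    and "distinct bs" "set bs = bosons"
    and "distinct fs" "set fs = fermions"
    and "X = boson_fermion_mat E \<mu> bs fs"
    and "L = signed_laplacian N X"
  shows "(\<forall>ds. invariant_factors X ds \<longrightarrow>
            (\<forall>d \<in> set (take (card V div 4) ds). (\<exists>k. d = 2 ^ k) \<and> d dvd int N) \<and>
            (\<forall>d \<in> set (drop (card V div 4) ds). \<exists>k. d * 2 ^ k = int N)) \<and>
         (\<forall>ds. invariant_factors L ds \<longrightarrow>
            (\<forall>d \<in> set (take (card V div 2) ds). (\<exists>k. d = 2 ^ k) \<and> d dvd int N) \<and>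
            (\<forall>d \<in> set (drop (card V div 2) ds). \<exists>k. d * 2 ^ k = int N * (int N - 1)))"
proof -
  interpret adinkra V E \<mu> N bosons fermions color h by fact
  define n where "n = length bs"
  interpret adinkra_matrices n N X "color_mat 1 bs fs"
    using matrix_relations[OF assms(2-5)] matrix_relations_transposed[OF assms(2-5)] N_pos
    by unfold_locales (simp_all add: assms(6) n_def)
  have V: "card V = 2 * n"
    using card_vertices assms(2,3) distinct_card by (metis n_def)
  have "(\<forall>d \<in> set (take (card V div 4) ds). (\<exists>k. d = 2 ^ k) \<and> d dvd int N) \<and>
        (\<forall>d \<in> set (drop (card V div 4) ds). \<exists>k. d * 2 ^ k = int N)"
    if inv: "invariant_factors X ds" for ds
  proof -
    obtain D where "smith_normal_form_of X D" and ds: "ds = diag_mat D"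
      using inv by (auto simp: invariant_factors_def)
    note D = smith_normal_form_ofE[OF this(1) X]
    have nth: "length ds = n" "\<And>i. i < n \<Longrightarrow> ds ! i = D $$ (i, i)"
      using smith_diagonal.carrier[OF D(1)] by (auto simp: ds diag_mat_def)
    show ?thesis
    proof (rule ball_set_take_drop; unfold nth(1))
      fix i assume i: "i < n" "i < card V div 4"
      then have "D $$ (i, i) dvd int N" using invariant_factors_X(2)[OF D i(1)] by (metis dvd_triv_left)
      moreover have "\<exists>k. D $$ (i, i) = 2 ^ k" using invariant_factors_X(1)[OF D, of i] i V by simp
      ultimately show "(\<exists>k. ds ! i = 2 ^ k) \<and> ds ! i dvd int N" using i nth(2) by simp
    next
      fix i assume i: "i < n" "card V div 4 \<le> i"
      \<comment> \<open>The rounding in n div 2 matters only for N = 1, when n may be odd; the complementary index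
        of the middle position is then the middle position itself, still below n / 2.\<close>
      have "n div 2 \<le> i" using i(2) V by simp
      then have "2 * (n - 1 - i) < n" using i(1) by linarith
      then obtain k where "D $$ (n - 1 - i, n - 1 - i) = 2 ^ k"
        using invariant_factors_X(1)[OF D, of "n - 1 - i"] by auto
      then show "\<exists>k. ds ! i * 2 ^ k = int N"
        using invariant_factors_X(2)[OF D i(1)] nth(2)[OF i(1)] by auto
    qed
  qed
  moreover have "(\<forall>d \<in> set (take (card V div 2) ds). (\<exists>k. d = 2 ^ k) \<and> d dvd int N) \<and>
        (\<forall>d \<in> set (drop (card V div 2) ds). \<exists>k. d * 2 ^ k = int N * (int N - 1))"
    if inv: "invariant_factors L ds" for ds
  proof -
    have L: "L \<in> carrier_mat (n + n) (n + n)"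
      unfolding assms(7) laplacian_blocks using X by simp
    obtain D where "smith_normal_form_of L D" and ds: "ds = diag_mat D"
      using inv by (auto simp: invariant_factors_def)
    note D = smith_normal_form_ofE[OF this(1) L, unfolded assms(7)]
    have nth: "length ds = n + n" "\<And>i. i < n + n \<Longrightarrow> ds ! i = D $$ (i, i)"
      using smith_diagonal.carrier[OF D(1)] by (auto simp: ds diag_mat_def)
    show ?thesis
    proof (rule ball_set_take_drop; unfold nth(1))
      fix i assume i: "i < n + n" "i < card V div 2"
      then show "(\<exists>k. ds ! i = 2 ^ k) \<and> ds ! i dvd int N"
        using invariant_factors_L(1,2)[OF D, of i] nth(2) V by simp
    next
      fix i assume i: "i < n + n" "card V div 2 \<le> i"
      then have "n + n - 1 - i < n" using V by simp
      then obtain k where "D $$ (n + n - 1 - i, n + n - 1 - i) = 2 ^ k"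
        using invariant_factors_L(1)[OF D, of "n + n - 1 - i"] by auto
      then show "\<exists>k. ds ! i * 2 ^ k = int N * (int N - 1)"
        using invariant_factors_L(3)[OF D i(1)] nth(2)[OF i(1)] by auto
    qed
  qed
  ultimately show ?thesis by blast
qed

end
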